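(* Let $K$ be a field in which $2\neq 0$, and let $\lambda\in K\setminus\{0,1\}$. Let $E$ be the Legendre elliptic curve $y^2=x(x+1)(x+\lambda)$ over $K$. Let $n\geq 4$ be any even integer, and let $u$ be an element of an algebraic closure of $K$ with $u^n=\lambda$. Then the point $$\left(u,\;u(u+1)\sqrt{\frac{u^{n-1}+1}{u+1}}\right)$$ is a $K\left[u,\sqrt{\frac{u^{n-1}+1}{u+1}}\right]$-valued point of $E$.
   Context: The symbol $\sqrt{\frac{u^{n-1}+1}{u+1}}$ denotes a chosen square root of $\frac{u^{n-1}+1}{u+1}$ in the algebraic closure of $K$. Since $n$ is even and $u^n=\lambda\neq 1$, one has $u\neq -1$, and $\frac{u^{n-1}+1}{u+1}=\sum_{i=0}^{n-2}(-1)^i u^i$. A Legendre elliptic curve over $K$ is a curve given by the equation $y^2=x(x+1)(x+\lambda)$. *)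

theory Defs
  imports "HOL-Algebra.Algebraic_Closure"
begin

datatype 'a curve_point = Infinity | Affine 'a 'a

text \<open>
  \<open>E(F)\<close> for the Legendre curve \<open>E : y\<^sup>2 = x(x + 1)(x + \<lambda>)\<close>, where \<open>F\<close> is a field containing \<open>\<lambda>\<close>.
  The projective closure of this affine curve has the single point \<open>[0 : 1 : 0]\<close> on the line at
  infinity, represented by \<^const>\<open>Infinity\<close>. To obtain the points with values in a subfield \<open>A\<close>
  of \<open>L\<close>, take \<open>F = L\<lparr>carrier := A\<rparr>\<close>.
\<close>
definition legendre_points :: "('a, 'b) ring_scheme \<Rightarrow> 'a \<Rightarrow> 'a curve_point set" where
  "legendre_points F lam =
     insert Infinity
       {Affine x y | x y. x \<in> carrier F \<and> y \<in> carrier F \<and>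
          y [^]\<^bsub>F\<^esub> (2::nat) =
            x \<otimes>\<^bsub>F\<^esub> (x \<oplus>\<^bsub>F\<^esub> \<one>\<^bsub>F\<^esub>) \<otimes>\<^bsub>F\<^esub> (x \<oplus>\<^bsub>F\<^esub> lam)}"

text \<open>
  For even \<open>n\<close> and \<open>u\<^sup>n \<noteq> 1\<close> the quotient \<open>(u\<^sup>n\<^sup>-\<^sup>1 + 1) / (u + 1)\<close> is a genuine one.
\<close>
lemma (in field) even_root_plus_one_nonzero:
  fixes n :: nat
  assumes "u \<in> carrier R" "even n" "u [^] n \<noteq> \<one>"
  shows "u \<oplus> \<one> \<noteq> \<zero>"
proof
  assume "u \<oplus> \<one> = \<zero>"
  then have u: "u = \<ominus> \<one>"
    using assms(1) minus_equality by fastforce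
  obtain k where k: "n = 2 * k"
    using assms(2) by blast
  have "u [^] (2::nat) = \<one>"
    by (simp add: u numeral_2_eq_2 l_minus r_minus)
  then have "u [^] n = \<one>"
    using assms(1) by (metis k nat_pow_one nat_pow_pow)
  with assms(3) show False by simp
qed

end

theory Submission
  imports Defs
begin

text \<open>Squaring the proposed y-coordinate gives u^2 (u+1)^2 (u^(n-1)+1)/(u+1). One factor u+1
  cancels the denominator, and one factor u turns u^(n-1)+1 into u^n+u, so u(u+1)(u+u^n) remains.
  With u^n = \<open>lam\<close> this is the right side of the curve equation at x = u. The
  computation is \<open>legendre_equation_at_root\<close>; its condition that u+1 be nonzero comes
  from \<open>even_root_plus_one_nonzero\<close>. Both coordinates are polynomials in u and s over
  the integers, hence lie in K[u, s].\<close>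

lemma (in field) legendre_equation_at_root:
  fixes n :: nat
  assumes "u \<in> carrier R" "s \<in> carrier R" "n > 0" "u \<oplus> \<one> \<noteq> \<zero>"
    and s: "s [^] (2::nat) = (u [^] (n - 1) \<oplus> \<one>) \<otimes> inv (u \<oplus> \<one>)"
  shows "(u \<otimes> (u \<oplus> \<one>) \<otimes> s) [^] (2::nat) = u \<otimes> (u \<oplus> \<one>) \<otimes> (u \<oplus> u [^] n)"
proof -
  define v w where "v = u \<oplus> \<one>" and "w = u [^] (n - 1) \<oplus> \<one>"
  have closed: "u \<in> carrier R" "v \<in> carrier R" "w \<in> carrier R" "inv v \<in> carrier R"
    and inv: "inv v \<otimes> v = \<one>"
    using assms field_Units by (auto simp: v_def w_def)
  \<comment> \<open>Positivity of \<open>n\<close> keeps the subtraction in \<open>n - 1\<close>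
    from truncating, so the exponents add up to \<open>n\<close>.\<close>
  have "w \<otimes> u = u \<oplus> u [^] n"
    using assms(1,3) nat_pow_Suc[of u "n - 1"] by (simp add: w_def l_distr a_comm)
  have "(u \<otimes> v \<otimes> s) [^] (2::nat) = (u \<otimes> v) \<otimes> (u \<otimes> v) \<otimes> s [^] (2::nat)"
    using closed assms(2) by (simp add: numeral_2_eq_2 m_ac)
  also have "\<dots> = (u \<otimes> v) \<otimes> (u \<otimes> v) \<otimes> (w \<otimes> inv v)"
    unfolding s v_def w_def ..
  also have "\<dots> = (u \<otimes> v) \<otimes> (w \<otimes> u) \<otimes> (inv v \<otimes> v)"
    using closed by (simp add: m_ac)
  also have "\<dots> = u \<otimes> v \<otimes> (u \<oplus> u [^] n)"
    using closed inv \<open>w \<otimes> u = _\<close> by simp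
  finally show ?thesis
    unfolding v_def .
qed

theorem theorem2p2:
  fixes L (structure) and K :: "'a set" and lam u s :: 'a and n :: nat
  assumes "algebraic_closure L K"
    and "\<one> \<oplus> \<one> \<noteq> \<zero>"
    and "lam \<in> K - {\<zero>, \<one>}"
    and "n \<ge> 4" and "even n"
    and "u \<in> carrier L" and "u [^] n = lam"
    and "s \<in> carrier L"
    and "s [^] (2::nat) = (u [^] (n - 1) \<oplus> \<one>) \<otimes> inv (u \<oplus> \<one>)"
  shows "Affine u (u \<otimes> (u \<oplus> \<one>) \<otimes> s)
           \<in> legendre_points (L\<lparr>carrier := ring.finite_extension L K [u, s]\<rparr>) lam"
proof -
  interpret algebraic_closure L K by fact
  define A where "A = finite_extension K [u, s]"
  have K: "subring K L"
    using subfieldE(1)[OF subfield_axioms] .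
  have us: "set [u, s] \<subseteq> carrier L"
    using assms(6,8) by simp
  \<comment> \<open>Being a subring is enough here: the coordinates are built from u, s and 1 by
    sums and products only.\<close>
  have A: "subring A L"
    unfolding A_def by (rule finite_extension_is_subring[OF K us])
  have mem: "u \<in> A" "s \<in> A"
    using finite_extension_mem[OF K us] unfolding A_def by auto
  then have "u \<otimes> (u \<oplus> \<one>) \<otimes> s \<in> A"
    by (intro subringE(6,7)[OF A] subringE(3)[OF A])
  \<comment> \<open>If u were -1, evenness of \<open>n\<close> would force \<open>lam\<close> = u^n
    = 1.\<close>
  moreover have "u \<oplus> \<one> \<noteq> \<zero>"
    using even_root_plus_one_nonzero[of u n] assms(3,5-7) by simp
  then have "(u \<otimes> (u \<oplus> \<one>) \<otimes> s) [^] (2::nat) = u \<otimes> (u \<oplus> \<one>) \<otimes> (u \<oplus> lam)"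
    using legendre_equation_at_root[of u s n] assms(4,6-9) by simp
  \<comment> \<open>Replacing the carrier leaves the operations of \<open>L\<close> unchanged;
    unfolding \<open>nat_pow_def\<close> shows that powers agree too.\<close>
  ultimately show ?thesis
    using mem unfolding legendre_points_def A_def by (simp add: nat_pow_def)
qed

end
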